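(* Let $p\ge2$ and $q\ge1$ be coprime integers, let $R>r>0$, and let $$x(t)=[R+r\cos(qt)]\cos(pt),\qquad y(t)=[R+r\cos(qt)]\sin(pt).$$ The relations $$x(t)=x(\tau),\qquad y(t)=y(\tau),\qquad t\not\equiv\tau \pmod{2\pi},$$ are valid if and only if the equalities $$t=t_{k,j}=\frac{k\pi}{p}+\frac{j\pi}{q},\qquad \tau=\tau_{k,j}=-\frac{k\pi}{p}+\frac{j\pi}{q}\pmod{2\pi}$$ are valid, where $k,j$ are integers with $1\le k\le p-1$, $0\le j\le q-1$.
   Context: The plane curve $(x(t),y(t))$, $t\in\mathbb{R}$, is the orthogonal projection onto the plane $(x,y)$ of the torus knot whose third coordinate is $z(t)=r\sin(qt)$.
   Formalization: The equalities t = t_{k,j}, τ = τ_{k,j} (mod 2π) are taken up to exchanging t and τ; the ordered "only if" fails, e.g. for p=2, q=1, t=−π/2, τ=π/2. *)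

theory Defs
  imports "HOL-Analysis.Analysis" "HOL-Library.Real_Mod"
begin

text \<open>
  The curve \<open>(torus_x p q R r t, torus_y p q R r t)\<close> is the orthogonal projection onto the
  \<open>(x, y)\<close>-plane of the torus knot whose third coordinate is \<open>r * sin (q * t)\<close>.
\<close>

definition torus_x :: "int \<Rightarrow> int \<Rightarrow> real \<Rightarrow> real \<Rightarrow> real \<Rightarrow> real" where
  "torus_x p q R r t = (R + r * cos (of_int q * t)) * cos (of_int p * t)"

definition torus_y :: "int \<Rightarrow> int \<Rightarrow> real \<Rightarrow> real \<Rightarrow> real \<Rightarrow> real" where
  "torus_y p q R r t = (R + r * cos (of_int q * t)) * sin (of_int p * t)"

definition node_t :: "int \<Rightarrow> int \<Rightarrow> int \<Rightarrow> int \<Rightarrow> real" where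
  "node_t p q k j = of_int k * pi / of_int p + of_int j * pi / of_int q"

definition node_tau :: "int \<Rightarrow> int \<Rightarrow> int \<Rightarrow> int \<Rightarrow> real" where
  "node_tau p q k j = - (of_int k * pi / of_int p) + of_int j * pi / of_int q"

text \<open>
  The two parameters of a double point form an unordered pair: the relations
  \<open>x(t) = x(\<tau>)\<close>, \<open>y(t) = y(\<tau>)\<close>, \<open>t \<noteq> \<tau>\<close> modulo \<open>2\<pi>\<close> are symmetric in \<open>t\<close> and \<open>\<tau>\<close>, whereas with
  \<open>0 \<le> j \<le> q - 1\<close> exactly one ordering of each such pair has the form \<open>(t\<^sub>k\<^sub>j, \<tau>\<^sub>k\<^sub>j)\<close>; the other
  ordering corresponds to the indices \<open>(p - k, j + q)\<close>.  Hence the disjunction.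
\<close>

definition node_params :: "int \<Rightarrow> int \<Rightarrow> int \<Rightarrow> int \<Rightarrow> real \<Rightarrow> real \<Rightarrow> bool" where
  "node_params p q k j t \<tau> \<longleftrightarrow>
     [t = node_t p q k j] (rmod (2 * pi)) \<and> [\<tau> = node_tau p q k j] (rmod (2 * pi)) \<or>
     [\<tau> = node_t p q k j] (rmod (2 * pi)) \<and> [t = node_tau p q k j] (rmod (2 * pi))"

end

theory Submission
  imports Defs
begin

text \<open>
  In complex notation the curve is \<open>(R + r * cos (q * t)) * cis (p * t)\<close>.  Since \<open>R > r > 0\<close>, the
  factor in front is positive, so it is the modulus: two parameters give the same point iff
  \<open>p * t\<close> and \<open>p * \<tau>\<close> agree modulo \<open>2\<pi>\<close> and \<open>cos (q * t) = cos (q * \<tau>)\<close>, that is, \<open>q * t\<close> agrees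
  with \<open>q * \<tau>\<close> or with \<open>- q * \<tau>\<close> modulo \<open>2\<pi>\<close>
  (lemma \<open>torus_point_eq_iff\<close>).  With the plus sign, a Bezout relation between \<open>p\<close> and
  \<open>q\<close> forces \<open>t \<equiv> \<tau>\<close> (\<open>rcong_if_rcong_coprime_mults\<close>), so a double point needs the minus sign.
  The conditions \<open>p * (t - \<tau>) \<in> 2\<pi>\<int>\<close> and \<open>q * (t + \<tau>) \<in> 2\<pi>\<int>\<close> are linear and are solved exactly
  by \<open>(t, \<tau>) = (t\<^sub>m\<^sub>n, \<tau>\<^sub>m\<^sub>n)\<close> for arbitrary integers \<open>m\<close>, \<open>n\<close> (\<open>node_pair_iff\<close>), and the
  parameters of such a pair are congruent iff \<open>p\<close> divides \<open>m\<close>.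

  What remains is to bring \<open>(m, n)\<close> into the stated range.  Moving \<open>(m, n)\<close> by
  \<open>(a * p, b * q)\<close> shifts both parameters by a multiple of \<open>\<pi>\<close>, with the parity of \<open>a + b\<close>.  If
  \<open>a + b\<close> is even, nothing changes modulo \<open>2\<pi>\<close>.  If it is odd, both parameters move by \<open>\<pi>\<close>,
  and replacing \<open>k\<close> by \<open>p - k\<close> undoes this at the price of exchanging \<open>t\<close> with \<open>\<tau>\<close>.  This is why
  the range \<open>0 \<le> j < q\<close> describes every double point, but only one order of its two parameters.
\<close>

section \<open>Coincident points of the curve\<close>

text \<open>
  Both sides of the two coordinate equations are polar coordinates with positive modulus.
\<close>

lemma torus_point_eq_iff:
  fixes p q :: int and R r t \<tau> :: real
  assumes "r > 0" and "R > r"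
  shows "torus_x p q R r t = torus_x p q R r \<tau> \<and> torus_y p q R r t = torus_y p q R r \<tau> \<longleftrightarrow>
           [of_int p * t = of_int p * \<tau>] (rmod (2 * pi)) \<and>
           ([of_int q * t = of_int q * \<tau>] (rmod (2 * pi)) \<or>
            [of_int q * t = - (of_int q * \<tau>)] (rmod (2 * pi)))"
    (is "?same \<longleftrightarrow> ?angle \<and> ?cosine")
proof -
  define \<rho> where "\<rho> s = R + r * cos (of_int q * s)" for s
  have pos: "\<rho> s > 0" for s
  proof -
    have "r * (-1) \<le> r * cos (of_int q * s)"
      using assms by (intro mult_left_mono) auto
    then show ?thesis
      using assms unfolding \<rho>_def by linarith
  qed
  have "?same \<longleftrightarrow> rcis (\<rho> t) (of_int p * t) = rcis (\<rho> \<tau>) (of_int p * \<tau>)"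
    by (simp add: torus_x_def torus_y_def \<rho>_def complex_eq_iff)
  also have "\<dots> \<longleftrightarrow> \<rho> t = \<rho> \<tau> \<and> cis (of_int p * t) = cis (of_int p * \<tau>)"
  proof
    assume eq: "rcis (\<rho> t) (of_int p * t) = rcis (\<rho> \<tau>) (of_int p * \<tau>)"
    then have "\<bar>\<rho> t\<bar> = \<bar>\<rho> \<tau>\<bar>"
      by (metis complex_mod_rcis)
    then have "\<rho> t = \<rho> \<tau>"
      using pos[of t] pos[of \<tau>] by linarith
    with eq pos[of \<tau>] show "\<rho> t = \<rho> \<tau> \<and> cis (of_int p * t) = cis (of_int p * \<tau>)"
      by (simp add: rcis_def)
  qed (simp add: rcis_def)
  also have "\<dots> \<longleftrightarrow> cos (of_int q * t) = cos (of_int q * \<tau>) \<and> ?angle"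
    using assms by (simp add: \<rho>_def cis_eq_iff)
  also have "\<dots> \<longleftrightarrow> ?angle \<and> ?cosine"
    by (auto simp: cos_eq_cos_conv_rmod_iff)
  finally show ?thesis .
qed

text \<open>
  If \<open>a * p + b * q = 1\<close>, then \<open>t\<close> is the combination of \<open>p * t\<close> and \<open>q * t\<close> with the
  integer coefficients \<open>a\<close> and \<open>b\<close>.
\<close>

lemma rcong_if_rcong_coprime_mults:
  fixes p q :: int and t \<tau> m :: real
  assumes "coprime p q"
    and p: "[of_int p * t = of_int p * \<tau>] (rmod m)"
    and q: "[of_int q * t = of_int q * \<tau>] (rmod m)"
  shows "[t = \<tau>] (rmod m)"
proof -
  obtain a b where "a * p + b * q = 1"
    using bezout_int[of p q] assms(1) by auto
  then have bezout: "of_int a * of_int p + of_int b * of_int q = (1 :: real)"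
    by (metis of_int_1 of_int_add of_int_mult)
  obtain k where k: "of_int p * \<tau> = of_int p * t + of_int k * m"
    using p by (auto simp: rcong_altdef)
  obtain l where l: "of_int q * \<tau> = of_int q * t + of_int l * m"
    using q by (auto simp: rcong_altdef)
  have "\<tau> = (of_int a * of_int p + of_int b * of_int q) * \<tau>"
    by (simp add: bezout)
  also have "\<dots> = of_int a * (of_int p * \<tau>) + of_int b * (of_int q * \<tau>)"
    by (simp add: algebra_simps)
  also have "\<dots> = (of_int a * of_int p + of_int b * of_int q) * t + of_int (a * k + b * l) * m"
    unfolding k l by (simp add: algebra_simps)
  finally have "\<tau> = t + of_int (a * k + b * l) * m"
    by (simp add: bezout)
  then show ?thesis
    unfolding rcong_altdef by blast
qed

section \<open>Node parameters with arbitrary integer indices\<close>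

text \<open>
  The two congruences fix \<open>t - \<tau> = 2\<pi>m/p\<close> and \<open>t + \<tau> = 2\<pi>n/q\<close>; half the sum and half the
  difference of these are the node parameters.
\<close>

lemma node_pair_iff:
  fixes p q :: int and t \<tau> :: real
  assumes "p \<noteq> 0" and "q \<noteq> 0"
  shows "[of_int p * t = of_int p * \<tau>] (rmod (2 * pi)) \<and>
         [of_int q * t = - (of_int q * \<tau>)] (rmod (2 * pi)) \<longleftrightarrow>
         (\<exists>m n. t = node_t p q m n \<and> \<tau> = node_tau p q m n)"
proof
  assume cong: "[of_int p * t = of_int p * \<tau>] (rmod (2 * pi)) \<and>
    [of_int q * t = - (of_int q * \<tau>)] (rmod (2 * pi))"
  obtain k where "of_int p * \<tau> = of_int p * t + of_int k * (2 * pi)"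
    using cong by (auto simp: rcong_altdef)
  then have diff: "\<tau> - t = 2 * (of_int k * pi / of_int p)"
    using assms by (simp add: field_simps)
  obtain l where "- (of_int q * \<tau>) = of_int q * t + of_int l * (2 * pi)"
    using cong by (auto simp: rcong_altdef)
  then have "of_int q * (\<tau> + t) = - (2 * (of_int l * pi))"
    by (simp add: algebra_simps)
  then have sum: "\<tau> + t = - (2 * (of_int l * pi / of_int q))"
    using assms by (simp add: field_simps)
  have node: "node_t p q (- k) (- l) = - (of_int k * pi / of_int p) - of_int l * pi / of_int q"
    "node_tau p q (- k) (- l) = of_int k * pi / of_int p - of_int l * pi / of_int q"
    by (simp_all add: node_t_def node_tau_def)
  have "t = node_t p q (- k) (- l) \<and> \<tau> = node_tau p q (- k) (- l)"
    unfolding node using diff sum by argo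
  then show "\<exists>m n. t = node_t p q m n \<and> \<tau> = node_tau p q m n"
    by blast
next
  assume "\<exists>m n. t = node_t p q m n \<and> \<tau> = node_tau p q m n"
  then obtain m n where t: "t = node_t p q m n" and \<tau>: "\<tau> = node_tau p q m n"
    by blast
  have "of_int p * \<tau> = of_int p * t + of_int (- m) * (2 * pi)"
    and "- (of_int q * \<tau>) = of_int q * t + of_int (- n) * (2 * pi)"
    using assms by (simp_all add: t \<tau> node_t_def node_tau_def field_simps)
  then show "[of_int p * t = of_int p * \<tau>] (rmod (2 * pi)) \<and>
    [of_int q * t = - (of_int q * \<tau>)] (rmod (2 * pi))"
    unfolding rcong_altdef by blast
qed

lemma node_t_rcong_node_tau_iff:
  assumes "p \<noteq> 0"
  shows "[node_t p q m n = node_tau p q m n] (rmod (2 * pi)) \<longleftrightarrow> p dvd m"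
proof -
  have "node_tau p q m n = node_t p q m n + of_int i * (2 * pi) \<longleftrightarrow> m = p * (- i)" for i
  proof -
    have "node_tau p q m n = node_t p q m n + of_int i * (2 * pi) \<longleftrightarrow>
        (2 * pi) * of_int m = (2 * pi) * (of_int p * of_int (- i))"
      using assms by (auto simp: node_t_def node_tau_def field_simps)
    also have "\<dots> \<longleftrightarrow> real_of_int m = of_int (p * (- i))"
      by (subst mult_left_cancel) simp_all
    finally show ?thesis
      by (simp only: of_int_eq_iff)
  qed
  then show ?thesis
    unfolding rcong_altdef dvd_def by (metis minus_minus)
qed

lemma node_uminus:
  "node_t p q (- k) j = node_tau p q k j" "node_tau p q (- k) j = node_t p q k j"
  by (simp_all add: node_t_def node_tau_def)

lemma node_shift:
  assumes "p \<noteq> 0" and "q \<noteq> 0"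
  shows "node_t p q (k + a * p) (j + b * q) = node_t p q k j + of_int (b + a) * pi"
    and "node_tau p q (k + a * p) (j + b * q) = node_tau p q k j + of_int (b - a) * pi"
  using assms by (simp_all add: node_t_def node_tau_def field_simps)

lemma rcong_add_even_pi:
  assumes "even n"
  shows "[x + of_int n * pi = x] (rmod (2 * pi))"
proof -
  obtain i where "n = 2 * i"
    using assms by blast
  then have "x = x + of_int n * pi + of_int (- i) * (2 * pi)"
    by simp
  then show ?thesis
    unfolding rcong_altdef by blast
qed

text \<open>
  Both shifts in \<open>node_shift\<close> are even multiples of \<open>\<pi>\<close>, since \<open>b + a\<close> and \<open>b - a\<close> have the
  same parity.
\<close>

lemma node_shift_even:
  assumes "p \<noteq> 0" and "q \<noteq> 0" and "even (b + a)"
  shows "[node_t p q (k + a * p) (j + b * q) = node_t p q k j] (rmod (2 * pi))"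
    and "[node_tau p q (k + a * p) (j + b * q) = node_tau p q k j] (rmod (2 * pi))"
  unfolding node_shift[OF assms(1,2)] using assms(3)
  by (rule rcong_add_even_pi, intro rcong_add_even_pi) simp

text \<open>
  Conversely, independent multiples of \<open>2\<pi>\<close> added to the two parameters can be absorbed into the
  indices: adding \<open>2\<pi>a\<close> and \<open>2\<pi>b\<close> requires \<open>\<beta> + \<alpha> = 2a\<close> and \<open>\<beta> - \<alpha> = 2b\<close> in
  \<open>node_shift\<close>, hence \<open>\<alpha> = a - b\<close> and \<open>\<beta> = a + b\<close>.
\<close>

lemma rcong_node_obtains_indices:
  assumes "p \<noteq> 0" and "q \<noteq> 0"
    and t: "[t = node_t p q k j] (rmod (2 * pi))"
    and \<tau>: "[\<tau> = node_tau p q k j] (rmod (2 * pi))"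
  obtains m n where "t = node_t p q m n" and "\<tau> = node_tau p q m n" and "p dvd m \<longleftrightarrow> p dvd k"
proof -
  obtain a where a: "t = node_t p q k j + of_int a * (2 * pi)"
    using rcong_sym[OF t] by (auto simp: rcong_altdef)
  obtain b where b: "\<tau> = node_tau p q k j + of_int b * (2 * pi)"
    using rcong_sym[OF \<tau>] by (auto simp: rcong_altdef)
  show thesis
  proof
    show "t = node_t p q (k + (a - b) * p) (j + (a + b) * q)"
      using assms(1,2) by (simp add: node_shift a)
    show "\<tau> = node_tau p q (k + (a - b) * p) (j + (a + b) * q)"
      using assms(1,2) by (simp add: node_shift b)
    show "p dvd k + (a - b) * p \<longleftrightarrow> p dvd k"
      by (simp add: dvd_add_left_iff)
  qed
qed

section \<open>Reduction of the indices\<close>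

text \<open>
  Division with remainder gives \<open>m = k + a * p\<close> and \<open>n = j + b * q\<close>.  For even \<open>b + a\<close> the indices
  \<open>(k, j)\<close> describe the same pair.  For odd \<open>b + a\<close>, write \<open>-m = (p - k) - (a + 1) * p\<close>:
  negating \<open>m\<close> exchanges the two parameters, and now \<open>b - (a + 1)\<close> is even.
\<close>

lemma node_params_reduce:
  assumes "p > 0" and "q > 0" and "\<not> p dvd m"
  shows "\<exists>k j. 1 \<le> k \<and> k \<le> p - 1 \<and> 0 \<le> j \<and> j \<le> q - 1 \<and>
           node_params p q k j (node_t p q m n) (node_tau p q m n)"
proof -
  define k j where "k = m mod p" and "j = n mod q"
  define a b where "a = m div p" and "b = n div q"
  have m: "m = k + a * p" and n: "n = j + b * q"
    by (simp_all add: k_def j_def a_def b_def)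
  have "k \<noteq> 0"
    using assms(3) by (simp add: k_def dvd_eq_mod_eq_0)
  then have k: "1 \<le> k" "k \<le> p - 1"
    using assms(1) pos_mod_bound[of p m] pos_mod_sign[of p m] unfolding k_def by linarith+
  have j: "0 \<le> j" "j \<le> q - 1"
    using assms(2) pos_mod_bound[of q n] pos_mod_sign[of q n] unfolding j_def by linarith+
  show ?thesis
  proof (cases "even (b + a)")
    case True
    then have "node_params p q k j (node_t p q m n) (node_tau p q m n)"
      using node_shift_even[of p q b a k j] assms(1,2) by (simp add: node_params_def m n)
    with k j show ?thesis
      by blast
  next
    case False
    have neg_m: "- m = (p - k) + (- (a + 1)) * p"
      by (simp add: m algebra_simps)
    have even: "even (b + (- (a + 1)))"
      using False by simp
    have "[node_t p q (- m) n = node_t p q (p - k) j] (rmod (2 * pi))"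
      and "[node_tau p q (- m) n = node_tau p q (p - k) j] (rmod (2 * pi))"
      unfolding neg_m n using assms(1,2) even by (intro node_shift_even; simp)+
    then have "node_params p q (p - k) j (node_t p q m n) (node_tau p q m n)"
      by (simp add: node_params_def node_uminus)
    moreover have "1 \<le> p - k" "p - k \<le> p - 1"
      using k by linarith+
    ultimately show ?thesis
      using j by blast
  qed
qed

lemma node_params_range_iff:
  assumes "p > 0" and "q > 0"
  shows "(\<exists>k j. 1 \<le> k \<and> k \<le> p - 1 \<and> 0 \<le> j \<and> j \<le> q - 1 \<and> node_params p q k j t \<tau>) \<longleftrightarrow>
         (\<exists>m n. t = node_t p q m n \<and> \<tau> = node_tau p q m n \<and> \<not> p dvd m)"
proof
  assume "\<exists>k j. 1 \<le> k \<and> k \<le> p - 1 \<and> 0 \<le> j \<and> j \<le> q - 1 \<and> node_params p q k j t \<tau>"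
  then obtain k j where k: "1 \<le> k" "k \<le> p - 1" and params: "node_params p q k j t \<tau>"
    by blast
  have not_dvd: "\<not> p dvd k"
    using k zdvd_not_zless[of k p] by linarith
  \<comment> \<open>In the swapped case the pair has the indices \<open>(-k, j)\<close>.\<close>
  obtain k' where "\<not> p dvd k'" and "[t = node_t p q k' j] (rmod (2 * pi))"
    and "[\<tau> = node_tau p q k' j] (rmod (2 * pi))"
    using params not_dvd unfolding node_params_def by (metis dvd_minus_iff node_uminus)
  then show "\<exists>m n. t = node_t p q m n \<and> \<tau> = node_tau p q m n \<and> \<not> p dvd m"
    using assms rcong_node_obtains_indices[of p q t k' j \<tau>] by (metis less_irrefl)
next
  assume "\<exists>m n. t = node_t p q m n \<and> \<tau> = node_tau p q m n \<and> \<not> p dvd m"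
  then show "\<exists>k j. 1 \<le> k \<and> k \<le> p - 1 \<and> 0 \<le> j \<and> j \<le> q - 1 \<and> node_params p q k j t \<tau>"
    using node_params_reduce[OF assms] by blast
qed

section \<open>The double points\<close>

theorem theorem14p2:
  fixes p q :: int and R r t \<tau> :: real
  assumes "p \<ge> 2" and "q \<ge> 1" and "coprime p q" and "r > 0" and "R > r"
  shows "torus_x p q R r t = torus_x p q R r \<tau> \<and> torus_y p q R r t = torus_y p q R r \<tau> \<and>
           \<not> [t = \<tau>] (rmod (2 * pi)) \<longleftrightarrow>
         (\<exists>k j :: int. 1 \<le> k \<and> k \<le> p - 1 \<and> 0 \<le> j \<and> j \<le> q - 1 \<and> node_params p q k j t \<tau>)"
    (is "?double \<longleftrightarrow> ?node")
proof -
  have pq: "p > 0" "q > 0" "p \<noteq> 0" "q \<noteq> 0"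
    using assms(1,2) by linarith+
  have "?double \<longleftrightarrow>
      ([of_int p * t = of_int p * \<tau>] (rmod (2 * pi)) \<and>
       [of_int q * t = - (of_int q * \<tau>)] (rmod (2 * pi))) \<and> \<not> [t = \<tau>] (rmod (2 * pi))"
    using torus_point_eq_iff[OF assms(4,5), of p q t \<tau>]
      rcong_if_rcong_coprime_mults[OF assms(3), of t \<tau> "2 * pi"]
    by blast
  also have "\<dots> \<longleftrightarrow> (\<exists>m n. t = node_t p q m n \<and> \<tau> = node_tau p q m n \<and> \<not> p dvd m)"
    unfolding node_pair_iff[OF pq(3,4)] using node_t_rcong_node_tau_iff[OF pq(3)] by blast
  also have "\<dots> \<longleftrightarrow> ?node"
    using node_params_range_iff[OF pq(1,2)] by simp
  finally show ?thesis .
qed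

end
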